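(* Let $\lambda\ge0$, $\mu,\kappa>0$ and put $\theta=\lambda/\mu$, $\gamma=\kappa/\mu$. The stationary distribution $\pi$ of the M/M/1+M queue with random resetting with abandonment rate $\nu=\mu$, equivalently of the M/M/$\infty$ queue with random resetting (see context), is $$\pi_k=\frac{\theta^k}{k!}\int_0^1\gamma(1-t)^{\gamma-1}t^ke^{-\theta t}\,dt,\qquad k=0,1,2,\dots,$$ and this equals the series $$\sum_{j=0}^\infty\theta^{k+j}(-1)^j\frac{(k+j)!}{j!\,k!}\sum_{l=0}^{k+j}\frac{(-1)^l}{l!\,(k+j-l)!}\cdot\frac{\gamma}{\gamma+l}.$$ In particular $\pi$ is a mixed Poisson distribution: if $Y$ has density $\gamma(1-y)^{\gamma-1}$ on $(0,1)$ and, conditionally on $Y$, $X$ is Poisson with parameter $\theta Y$, then $\pi_n=\mathbb{P}(X=n)$ for all $n\ge0$.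
   Context: With $\nu=\mu$, both queues are described by the continuous-time Markov chain on $\mathbb{Z}_+$ with transition mechanisms: $i\to i+1$ at rate $\lambda$ ($i\ge0$, arrival); $i\to i-1$ at rate $i\mu$ ($i\ge1$, departure); $i\to0$ at rate $\kappa$ ($i\ge1$, resetting). It has a unique stationary distribution. Convention: $\theta^0=1$. *)

theory Defs
  imports "HOL-Probability.Probability"
begin

text \<open>
  A chain on the natural numbers is given by its jump rates \<open>r i j\<close> for \<open>i \<noteq> j\<close>;
  the diagonal values \<open>r i i\<close> play no role. The generator is conservative.
\<close>

definition generator :: "(nat \<Rightarrow> nat \<Rightarrow> real) \<Rightarrow> nat \<Rightarrow> nat \<Rightarrow> real" where
  "generator r i j = (if i = j then - (\<Sum>\<^sub>\<infinity>k\<in>- {i}. r i k) else r i j)"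

text \<open>
  \<open>P t i\<close> is the law at time \<open>t\<close> of the chain started in \<open>i\<close>. Only times \<open>t \<ge> 0\<close> matter.
  The conditions are the semigroup property and that the derivative at time \<open>0\<close>
  (from the right) is the generator; rows sum to one because \<open>P t i\<close> is a pmf.
\<close>

definition ctmc :: "(nat \<Rightarrow> nat \<Rightarrow> real) \<Rightarrow> (real \<Rightarrow> nat \<Rightarrow> nat pmf) \<Rightarrow> bool" where
  "ctmc r P \<longleftrightarrow>
     (\<forall>i. P 0 i = return_pmf i) \<and>
     (\<forall>s\<ge>0. \<forall>t\<ge>0. \<forall>i. P (s + t) i = bind_pmf (P s i) (P t)) \<and>
     (\<forall>i j. ((\<lambda>t. pmf (P t i) j) has_real_derivative generator r i j) (at 0 within {0..}))"

definition stationary_distribution :: "(real \<Rightarrow> nat \<Rightarrow> nat pmf) \<Rightarrow> nat pmf \<Rightarrow> bool" where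
  "stationary_distribution P \<pi> \<longleftrightarrow> (\<forall>t\<ge>0. bind_pmf \<pi> (P t) = \<pi>)"

text \<open>
  Arrivals at rate \<open>lam\<close>, departures at rate \<open>d i\<close> and resetting at rate \<open>\<kappa>\<close>.
  In state \<open>1\<close> a departure and a resetting lead to the same state \<open>0\<close>, so their rates add up.
\<close>

definition reset_queue_rate :: "real \<Rightarrow> (nat \<Rightarrow> real) \<Rightarrow> real \<Rightarrow> nat \<Rightarrow> nat \<Rightarrow> real" where
  "reset_queue_rate lam d \<kappa> i j =
     (if j = i + 1 then lam else 0)
     + (if i \<ge> 1 \<and> j = i - 1 then d i else 0)
     + (if i \<ge> 1 \<and> j = 0 then \<kappa> else 0)"

text \<open>
  M/M/1+M: one customer is in service, at rate \<open>\<mu>\<close>, and each of the \<open>i - 1\<close> waiting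
  customers abandons at rate \<open>\<nu>\<close>.
\<close>

definition mm1m_reset_rate :: "real \<Rightarrow> real \<Rightarrow> real \<Rightarrow> real \<Rightarrow> nat \<Rightarrow> nat \<Rightarrow> real" where
  "mm1m_reset_rate lam \<mu> \<nu> \<kappa> = reset_queue_rate lam (\<lambda>i. \<mu> + real (i - 1) * \<nu>) \<kappa>"

definition mminf_reset_rate :: "real \<Rightarrow> real \<Rightarrow> real \<Rightarrow> nat \<Rightarrow> nat \<Rightarrow> real" where
  "mminf_reset_rate lam \<mu> \<kappa> = reset_queue_rate lam (\<lambda>i. real i * \<mu>) \<kappa>"

text \<open>
  The library's \<^const>\<open>poisson_pmf\<close> requires a positive parameter; here the parameter
  may be \<open>0\<close>, which gives the point mass at \<open>0\<close> since \<open>0 ^ 0 = 1\<close>.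
\<close>

definition poisson_mass :: "real \<Rightarrow> nat \<Rightarrow> real" where
  "poisson_mass a n = a ^ n / fact n * exp (- a)"

definition cond_poisson ::
  "'a measure \<Rightarrow> ('a \<Rightarrow> nat) \<Rightarrow> ('a \<Rightarrow> real) \<Rightarrow> (real \<Rightarrow> real) \<Rightarrow> bool" where
  "cond_poisson M X Y a \<longleftrightarrow>
     (\<forall>n. AE \<omega> in M.
        real_cond_exp M (vimage_algebra (space M) Y borel) (indicator {\<omega> \<in> space M. X \<omega> = n}) \<omega>
          = poisson_mass (a (Y \<omega>)) n)"

end

theory Submission
  imports Defs
begin

text \<open>
  Between resets the queue is an M/M/\<open>\<infinity>\<close> queue, so \<open>E\<^sub>i z^X(t)\<close> has an explicit form,
  identified as the only bounded solution of the backward equation with initial value \<open>z^i\<close>.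
  Uniqueness follows from a maximum principle with the Lyapunov function \<open>1 + i\<close>. Since resets
  occur at rate \<open>\<kappa>\<close>, the dependence on the initial state decays like \<open>exp (- \<kappa> t)\<close>, so the
  generating function of any stationary distribution is the limit
  \<open>E exp (- \<theta> (1 - z) Y)\<close>, where \<open>1 - Y = exp (- \<mu> \<tau>)\<close> and \<open>\<tau>\<close>, the time since the
  last reset, is exponential with rate \<open>\<kappa>\<close>. This is the generating function of the mixed
  Poisson distribution. Conversely the explicit form shows that this distribution is preserved.
\<close>

subsection \<open>The mixed Poisson distribution\<close>

text \<open>The Beta(1, \<gamma>) law. The density is spelled as in the final theorem, so that the
  law of \<open>Y\<close> there is literally \<open>beta1 \<gamma>\<close>.\<close>

definition beta1 :: "real \<Rightarrow> real measure" where
  "beta1 \<gamma> = density lborel (\<lambda>y. ennreal (indicator {0<..<1} y * (\<gamma> * (1 - y) powr (\<gamma> - 1))))"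

lemma sets_beta1 [simp, measurable_cong]: "sets (beta1 \<gamma>) = sets borel"
  and space_beta1 [simp]: "space (beta1 \<gamma>) = UNIV"
  by (simp_all add: beta1_def)

lemma AE_beta1I:
  assumes "\<And>y. 0 < y \<Longrightarrow> y < 1 \<Longrightarrow> Q y"
  shows "AE y in beta1 \<gamma>. Q y"
  using assms unfolding beta1_def by (subst AE_density) (auto simp: indicator_def)

text \<open>Reflecting \<open>x\<close> to \<open>1 - x\<close> turns the density into a pure power,
  so these moments are elementary; hence \<open>1 - y\<close> is the basic variable below. The case
  \<open>n = 0\<close> gives total mass one.\<close>

lemma nn_integral_beta1_one_minus_power:
  assumes "\<gamma> > 0"
  shows "(\<integral>\<^sup>+y. ennreal ((1 - y) ^ n) \<partial>beta1 \<gamma>) = ennreal (\<gamma> / (\<gamma> + real n))"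
proof -
  have "((\<lambda>x. x powr (\<gamma> + n - 1)) has_integral 1 / (\<gamma> + n)) {0..1}"
    using has_integral_powr_from_0[of "\<gamma> + n - 1" 1] assms by simp
  from has_integral_affinity[of _ _ 0 1 "-1" 1, OF this[folded box_real]]
  have "((\<lambda>x. (1 - x) powr (\<gamma> + n - 1)) has_integral 1 / (\<gamma> + n)) {0..1}"
    by simp
  then have "((\<lambda>x. \<gamma> * (1 - x) powr (\<gamma> + n - 1)) has_integral \<gamma> * (1 / (\<gamma> + n))) {0..1}"
    by (rule has_integral_mult_right)
  then have "((\<lambda>x. \<gamma> * (1 - x) powr (\<gamma> + n - 1)) has_integral \<gamma> / (\<gamma> + n)) {0<..<1}"
    by (simp add: has_integral_Icc_iff_Ioo)
  then have "((\<lambda>x. if x \<in> {0<..<1} then \<gamma> * (1 - x) powr (\<gamma> + n - 1) else 0) has_integral \<gamma> / (\<gamma> + n)) UNIV"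
    by (simp only: has_integral_restrict_UNIV)
  then have I: "((\<lambda>x. indicator {0<..<1} x * (\<gamma> * (1 - x) powr (\<gamma> + n - 1))) has_integral \<gamma> / (\<gamma> + n)) UNIV"
    by (rule has_integral_cong[THEN iffD1, rotated]) auto
  have "(\<integral>\<^sup>+y. ennreal ((1 - y) ^ n) \<partial>beta1 \<gamma>) =
      (\<integral>\<^sup>+y. ennreal (indicator {0<..<1} y * (\<gamma> * (1 - y) powr (\<gamma> + n - 1))) \<partial>lborel)"
    unfolding beta1_def
  proof (subst nn_integral_density, goal_cases)
    case 3
    have "(1 - y) powr (\<gamma> - 1) * (1 - y) ^ n = (1 - y) powr (\<gamma> + n - 1)" if "y < 1" for y :: real
      using that by (simp add: powr_realpow[symmetric] powr_add[symmetric] algebra_simps)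
    then show ?case using assms
      by (intro nn_integral_cong) (auto simp: indicator_def ennreal_mult[symmetric] mult.assoc)
  qed auto
  also have "\<dots> = ennreal (\<gamma> / (\<gamma> + real n))"
    using assms by (intro nn_integral_has_integral_lborel I) auto
  finally show ?thesis .
qed

lemma prob_space_beta1: "\<gamma> > 0 \<Longrightarrow> prob_space (beta1 \<gamma>)"
  using nn_integral_beta1_one_minus_power[of \<gamma> 0] by (intro prob_spaceI) simp

lemma measure_beta1_UNIV: "\<gamma> > 0 \<Longrightarrow> measure (beta1 \<gamma>) UNIV = 1"
  using prob_space.prob_space[OF prob_space_beta1] by simp

lemma integrable_beta1_bounded:
  fixes f :: "real \<Rightarrow> real"
  assumes "\<gamma> > 0" "f \<in> borel_measurable borel" "\<And>y. 0 < y \<Longrightarrow> y < 1 \<Longrightarrow> \<bar>f y\<bar> \<le> B"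
  shows "integrable (beta1 \<gamma>) f"
proof -
  interpret prob_space "beta1 \<gamma>" using assms(1) by (rule prob_space_beta1)
  show ?thesis
    using assms by (intro integrable_const_bound[where B = B] AE_beta1I) auto
qed

lemma integral_beta1_one_minus_power:
  assumes "\<gamma> > 0"
  shows "(\<integral>y. (1 - y) ^ n \<partial>beta1 \<gamma>) = \<gamma> / (\<gamma> + real n)"
  using assms
  by (intro integral_eq_nn_integral[THEN trans] AE_beta1I)
     (auto simp: nn_integral_beta1_one_minus_power)

lemma
  fixes f :: "real \<Rightarrow> real"
  assumes "\<gamma> > 0" "f \<in> borel_measurable borel"
  shows integral_beta1: "(\<integral>y. f y \<partial>beta1 \<gamma>) = (LBINT y:{0<..<1}. \<gamma> * (1 - y) powr (\<gamma> - 1) * f y)"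
    and integrable_beta1_iff: "integrable (beta1 \<gamma>) f \<longleftrightarrow>
      set_integrable lborel {0<..<1} (\<lambda>y. \<gamma> * (1 - y) powr (\<gamma> - 1) * f y)"
  using assms unfolding beta1_def set_lebesgue_integral_def set_integrable_def
  by (simp_all add: integral_real_density integrable_real_density mult.assoc)

text \<open>Expanding \<open>y ^ m = (1 - (1 - y)) ^ m\<close> reduces to the moments of
  \<open>1 - y\<close>. This is the source of the inner sum in the series of the theorem.\<close>

lemma integral_beta1_monomial:
  assumes "\<gamma> > 0"
  shows "(\<integral>y. y ^ m \<partial>beta1 \<gamma>) =
    fact m * (\<Sum>l = 0..m. (- 1) ^ l / (fact l * fact (m - l)) * (\<gamma> / (\<gamma> + real l)))"
proof -
  have "y ^ m = (\<Sum>l = 0..m. real (m choose l) * (- 1) ^ l * (1 - y) ^ l)" for y :: real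
    using binomial_ring[of "-1 * (1 - y)" 1 m] unfolding power_mult_distrib
    by (simp add: atMost_atLeast0 mult.assoc)
  then have "(\<integral>y. y ^ m \<partial>beta1 \<gamma>) = (\<integral>y. (\<Sum>l = 0..m. real (m choose l) * (- 1) ^ l * (1 - y) ^ l) \<partial>beta1 \<gamma>)"
    by simp
  also have "\<dots> = (\<Sum>l = 0..m. real (m choose l) * (- 1) ^ l * (\<gamma> / (\<gamma> + real l)))"
    using assms
    by (subst Bochner_Integration.integral_sum)
       (auto intro!: integrable_mult_right integrable_beta1_bounded[where B = 1] power_le_one
         simp: integral_beta1_one_minus_power power_abs)
  also have "\<dots> = fact m * (\<Sum>l = 0..m. (- 1) ^ l / (fact l * fact (m - l)) * (\<gamma> / (\<gamma> + real l)))"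
    by (auto simp: sum_distrib_left binomial_fact intro!: sum.cong)
  finally show ?thesis .
qed

text \<open>A Weierstrass M-test: as \<open>beta1 \<gamma>\<close> has mass one and lives on the
  open unit interval, the \<open>B n\<close> bound the integrals too and allow termwise
  integration.\<close>

lemma sums_integral_beta1:
  fixes f :: "nat \<Rightarrow> real \<Rightarrow> real"
  assumes \<gamma>: "\<gamma> > 0" and [measurable]: "\<And>n. f n \<in> borel_measurable borel"
    and B: "\<And>n y. 0 < y \<Longrightarrow> y < 1 \<Longrightarrow> \<bar>f n y\<bar> \<le> B n" "summable B"
    and g: "\<And>y. 0 < y \<Longrightarrow> y < 1 \<Longrightarrow> (\<lambda>n. f n y) sums g y" "g \<in> borel_measurable borel"
  shows "(\<lambda>n. \<integral>y. f n y \<partial>beta1 \<gamma>) sums (\<integral>y. g y \<partial>beta1 \<gamma>)"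
proof -
  interpret prob_space "beta1 \<gamma>" using \<gamma> by (rule prob_space_beta1)
  have int: "integrable (beta1 \<gamma>) (f n)" for n
    by (rule integrable_beta1_bounded[OF \<gamma> _ B(1)]) auto
  have le: "(\<integral>y. norm (f n y) \<partial>beta1 \<gamma>) \<le> B n" for n
  proof -
    have "(\<integral>y. norm (f n y) \<partial>beta1 \<gamma>) \<le> (\<integral>y. B n \<partial>beta1 \<gamma>)"
      using B(1) int by (intro integral_mono_AE AE_beta1I) auto
    then show ?thesis using \<gamma> by (simp add: measure_beta1_UNIV)
  qed
  have "(\<lambda>n. \<integral>y. f n y \<partial>beta1 \<gamma>) sums (\<integral>y. (\<Sum>n. f n y) \<partial>beta1 \<gamma>)"
  proof (rule sums_integral[OF int])
    show "AE y in beta1 \<gamma>. summable (\<lambda>n. norm (f n y))"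
      using B by (intro AE_beta1I) (auto intro: summable_comparison_test')
    show "summable (\<lambda>n. \<integral>y. norm (f n y) \<partial>beta1 \<gamma>)"
      using le B(2) by (intro summable_comparison_test'[OF B(2), of 0]) auto
  qed
  also have "(\<integral>y. (\<Sum>n. f n y) \<partial>beta1 \<gamma>) = (\<integral>y. g y \<partial>beta1 \<gamma>)"
    using g by (intro integral_cong_AE AE_beta1I) (auto dest: sums_unique[symmetric])
  finally show ?thesis .
qed

lemma sums_exp: "(\<lambda>n. (x::real) ^ n / fact n) sums exp x"
  using exp_converges[of x] by (simp add: divide_inverse mult.commute)

text \<open>The moment generating function of \<open>1 - Y\<close> for \<open>Y\<close> with law \<open>beta1 \<gamma>\<close>.\<close>

definition beta1_mgf :: "real \<Rightarrow> real \<Rightarrow> real" where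
  "beta1_mgf \<gamma> x = (\<integral>y. exp (x * (1 - y)) \<partial>beta1 \<gamma>)"

lemma beta1_mgf_sums:
  assumes "\<gamma> > 0"
  shows "(\<lambda>n. \<gamma> / (\<gamma> + real n) / fact n * x ^ n) sums beta1_mgf \<gamma> x"
proof -
  have "(\<lambda>n. \<integral>y. x ^ n / fact n * (1 - y) ^ n \<partial>beta1 \<gamma>) sums beta1_mgf \<gamma> x"
    unfolding beta1_mgf_def
  proof (rule sums_integral_beta1[OF assms])
    show "\<bar>x ^ n / fact n * (1 - y) ^ n\<bar> \<le> \<bar>x\<bar> ^ n / fact n" if "0 < y" "y < 1" for n y
      using that power_le_one[of "1 - y" n]
      by (auto simp: abs_mult power_abs intro!: mult_left_le divide_right_mono)
    show "summable (\<lambda>n. \<bar>x\<bar> ^ n / fact n)"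
      using sums_exp by (rule sums_summable)
    show "(\<lambda>n. x ^ n / fact n * (1 - y) ^ n) sums exp (x * (1 - y))" for y
      using sums_exp[of "x * (1 - y)"] by (simp add: power_mult_distrib)
  qed auto
  then show ?thesis using assms by (simp add: integral_beta1_one_minus_power mult_ac)
qed

lemma beta1_mgf_bounds:
  assumes "\<gamma> > 0" "0 \<le> x"
  shows "0 \<le> beta1_mgf \<gamma> x" "beta1_mgf \<gamma> x \<le> exp x"
proof -
  have le: "exp (x * (1 - y)) \<le> exp x" if "0 < y" for y
    using that assms by (simp add: mult_left_le)
  have "integrable (beta1 \<gamma>) (\<lambda>y. exp (x * (1 - y)))"
    using assms le by (intro integrable_beta1_bounded[where B = "exp x"]) auto
  then have "beta1_mgf \<gamma> x \<le> (\<integral>y. exp x \<partial>beta1 \<gamma>)"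
    unfolding beta1_mgf_def using assms le integrable_beta1_bounded[of \<gamma> "\<lambda>_. exp x" "exp x"]
    by (intro integral_mono_AE AE_beta1I) auto
  then show "beta1_mgf \<gamma> x \<le> exp x" using assms by (simp add: measure_beta1_UNIV)
qed (simp add: beta1_mgf_def)

text \<open>For the power series coefficients the equation says
  \<open>(\<gamma> + n) * c n = \<gamma> / fact n\<close>. Multiplying the derivative by
  \<open>x\<close> avoids a singular form at \<open>x = 0\<close>.\<close>

lemma beta1_mgf_ode:
  assumes "\<gamma> > 0"
  obtains D where "(beta1_mgf \<gamma> has_real_derivative D) (at x)"
    "x * D + \<gamma> * beta1_mgf \<gamma> x = \<gamma> * exp x"
proof
  define c where "c n = \<gamma> / (\<gamma> + real n) / fact n" for n
  have sums: "(\<lambda>n. c n * x ^ n) sums beta1_mgf \<gamma> x" for x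
    unfolding c_def using assms by (rule beta1_mgf_sums)
  have eq: "beta1_mgf \<gamma> = (\<lambda>x. \<Sum>n. c n * x ^ n)"
    using sums by (auto simp: sums_iff)
  show der: "(beta1_mgf \<gamma> has_real_derivative (\<Sum>n. diffs c n * x ^ n)) (at x)"
    unfolding eq by (rule termdiffs_strong_converges_everywhere) (use sums in \<open>auto intro: sums_summable\<close>)
  have "(\<lambda>n. diffs c n * x ^ n) sums (\<Sum>n. diffs c n * x ^ n)"
    by (rule termdiffs_sums_strong[OF _ der, of "\<bar>x\<bar> + 1"]) (use sums in auto)
  then have "(\<lambda>n. x * (diffs c n * x ^ n)) sums (x * (\<Sum>n. diffs c n * x ^ n))"
    by (rule sums_mult)
  \<comment> \<open>The term at \<open>n = 0\<close> vanishes, so the index shift in the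
    differentiated series loses nothing.\<close>
  then have "(\<lambda>n. real n * c n * x ^ n) sums (x * (\<Sum>n. diffs c n * x ^ n))"
    using sums_Suc_iff[of "\<lambda>n. real n * c n * x ^ n"] by (simp add: diffs_def mult_ac)
  then have "(\<lambda>n. real n * c n * x ^ n + \<gamma> * (c n * x ^ n)) sums
      (x * (\<Sum>n. diffs c n * x ^ n) + \<gamma> * beta1_mgf \<gamma> x)"
    by (intro sums_add sums_mult sums)
  moreover have "real n * c n * x ^ n + \<gamma> * (c n * x ^ n) = \<gamma> * (x ^ n / fact n)" for n
  proof -
    have "real n * c n * x ^ n + \<gamma> * (c n * x ^ n) = (\<gamma> + real n) * c n * x ^ n"
      by (simp add: algebra_simps)
    also have "(\<gamma> + real n) * c n = \<gamma> / fact n"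
      using assms by (simp add: c_def)
    finally show ?thesis by simp
  qed
  ultimately have "(\<lambda>n. \<gamma> * (x ^ n / fact n)) sums
      (x * (\<Sum>n. diffs c n * x ^ n) + \<gamma> * beta1_mgf \<gamma> x)"
    by simp
  with sums_mult[OF sums_exp] show "x * (\<Sum>n. diffs c n * x ^ n) + \<gamma> * beta1_mgf \<gamma> x = \<gamma> * exp x"
    by (rule sums_unique2[symmetric])
qed

definition mixed_poisson_mass :: "real \<Rightarrow> real \<Rightarrow> nat \<Rightarrow> real" where
  "mixed_poisson_mass \<theta> \<gamma> k = (\<integral>y. poisson_mass (\<theta> * y) k \<partial>beta1 \<gamma>)"

lemma poisson_mass_nonneg: "a \<ge> 0 \<Longrightarrow> poisson_mass a n \<ge> 0"
  by (simp add: poisson_mass_def)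

lemma mixed_poisson_mass_nonneg: "\<theta> \<ge> 0 \<Longrightarrow> mixed_poisson_mass \<theta> \<gamma> k \<ge> 0"
  unfolding mixed_poisson_mass_def
  by (intro integral_nonneg_AE AE_beta1I) (auto intro: poisson_mass_nonneg)

text \<open>A Poisson law with parameter \<open>\<theta> * y\<close> has generating function
  \<open>exp (- a * y)\<close> with \<open>a = \<theta> * (1 - z)\<close>; writing it as
  \<open>exp (- a) * exp (a * (1 - y))\<close> brings in \<open>beta1_mgf\<close>.\<close>

lemma mixed_poisson_mass_pgf:
  assumes "\<theta> \<ge> 0" "\<gamma> > 0" "0 \<le> z"
  shows "(\<lambda>k. mixed_poisson_mass \<theta> \<gamma> k * z ^ k) sums
    (exp (- (\<theta> * (1 - z))) * beta1_mgf \<gamma> (\<theta> * (1 - z)))"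
proof -
  have "(\<lambda>k. \<integral>y. poisson_mass (\<theta> * y) k * z ^ k \<partial>beta1 \<gamma>) sums
      (\<integral>y. exp (- (\<theta> * (1 - z))) * exp (\<theta> * (1 - z) * (1 - y)) \<partial>beta1 \<gamma>)"
  proof (rule sums_integral_beta1[OF \<open>\<gamma> > 0\<close>])
    show "(\<lambda>y. poisson_mass (\<theta> * y) k * z ^ k) \<in> borel_measurable borel" for k
      by (simp add: poisson_mass_def)
    show "\<bar>poisson_mass (\<theta> * y) k * z ^ k\<bar> \<le> (\<theta> * z) ^ k / fact k" if "0 < y" "y < 1" for k y
    proof -
      have "\<bar>poisson_mass (\<theta> * y) k * z ^ k\<bar> = (\<theta> * z) ^ k / fact k * (y ^ k * exp (- (\<theta> * y)))"
        using assms that by (simp add: poisson_mass_def power_mult_distrib abs_mult)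
      also have "\<dots> \<le> (\<theta> * z) ^ k / fact k"
        using assms that by (intro mult_left_le mult_le_one power_le_one) auto
      finally show ?thesis .
    qed
    show "summable (\<lambda>k. (\<theta> * z) ^ k / fact k)"
      using sums_exp by (rule sums_summable)
    show "(\<lambda>k. poisson_mass (\<theta> * y) k * z ^ k) sums
        (exp (- (\<theta> * (1 - z))) * exp (\<theta> * (1 - z) * (1 - y)))" for y
    proof -
      have "(\<lambda>k. (\<theta> * y * z) ^ k / fact k * exp (- (\<theta> * y))) sums (exp (\<theta> * y * z) * exp (- (\<theta> * y)))"
        by (intro sums_mult2 sums_exp)
      also have "(\<lambda>k. (\<theta> * y * z) ^ k / fact k * exp (- (\<theta> * y))) = (\<lambda>k. poisson_mass (\<theta> * y) k * z ^ k)"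
        by (simp add: poisson_mass_def power_mult_distrib mult_ac)
      also have "exp (\<theta> * y * z) * exp (- (\<theta> * y)) = exp (- (\<theta> * (1 - z))) * exp (\<theta> * (1 - z) * (1 - y))"
        by (simp add: exp_add[symmetric] algebra_simps)
      finally show ?thesis .
    qed
  qed auto
  then show ?thesis
    by (simp add: mixed_poisson_mass_def beta1_mgf_def)
qed

lemma mixed_poisson_mass_eq_integral:
  assumes "\<gamma> > 0"
  shows "mixed_poisson_mass \<theta> \<gamma> k = \<theta> ^ k / fact k *
    (LBINT t:{0<..<1}. \<gamma> * (1 - t) powr (\<gamma> - 1) * t ^ k * exp (- \<theta> * t))"
proof -
  have "mixed_poisson_mass \<theta> \<gamma> k = (\<integral>t. \<theta> ^ k / fact k * (t ^ k * exp (- \<theta> * t)) \<partial>beta1 \<gamma>)"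
    by (simp add: mixed_poisson_mass_def poisson_mass_def power_mult_distrib mult.assoc)
  also have "\<dots> = \<theta> ^ k / fact k * (\<integral>t. t ^ k * exp (- \<theta> * t) \<partial>beta1 \<gamma>)"
    by (rule integral_mult_right_zero)
  finally show ?thesis
    using assms by (simp add: integral_beta1 mult.assoc)
qed

lemma mixed_poisson_mass_integrable:
  fixes \<theta> \<gamma> :: real
  assumes "\<theta> \<ge> 0" "\<gamma> > 0"
  shows "set_integrable lborel {0<..<1} (\<lambda>t. \<gamma> * (1 - t) powr (\<gamma> - 1) * t ^ k * exp (- \<theta> * t))"
proof -
  have "integrable (beta1 \<gamma>) (\<lambda>t. t ^ k * exp (- \<theta> * t))"
    using assms
    by (intro integrable_beta1_bounded[where B = 1])
       (auto simp: abs_mult power_abs intro!: mult_le_one power_le_one)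
  then show ?thesis
    using assms by (simp add: integrable_beta1_iff mult.assoc)
qed

text \<open>Expand \<open>exp (- (\<theta> * y))\<close> in powers, integrate termwise and insert
  \<open>integral_beta1_monomial\<close> with \<open>m = k + j\<close>, which also supplies the
  factor \<open>fact (k + j)\<close>.\<close>

lemma mixed_poisson_mass_sums:
  assumes "\<gamma> > 0"
  shows "(\<lambda>j. \<theta> ^ (k + j) * (- 1) ^ j * (fact (k + j) / (fact j * fact k)) *
      (\<Sum>l = 0..k + j. (- 1) ^ l / (fact l * fact (k + j - l)) * (\<gamma> / (\<gamma> + real l))))
    sums mixed_poisson_mass \<theta> \<gamma> k"
proof -
  have "(\<lambda>j. \<integral>y. \<theta> ^ (k + j) * (- 1) ^ j / (fact j * fact k) * y ^ (k + j) \<partial>beta1 \<gamma>)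
      sums mixed_poisson_mass \<theta> \<gamma> k"
    unfolding mixed_poisson_mass_def
  proof (rule sums_integral_beta1[OF assms])
    show "(\<lambda>j. \<theta> ^ (k + j) * (- 1) ^ j / (fact j * fact k) * y ^ (k + j)) sums poisson_mass (\<theta> * y) k" for y
      using sums_mult[OF sums_exp[of "- (\<theta> * y)"], of "(\<theta> * y) ^ k / fact k"]
      by (simp add: poisson_mass_def power_mult_distrib power_add power_minus[of "\<theta> * y"] mult_ac)
    show "\<bar>\<theta> ^ (k + j) * (- 1) ^ j / (fact j * fact k) * y ^ (k + j)\<bar> \<le>
        \<bar>\<theta>\<bar> ^ k / fact k * (\<bar>\<theta>\<bar> ^ j / fact j)" if "0 < y" "y < 1" for j y
    proof -
      have "\<bar>\<theta> ^ (k + j) * (- 1) ^ j / (fact j * fact k) * y ^ (k + j)\<bar> =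
          \<bar>\<theta>\<bar> ^ k / fact k * (\<bar>\<theta>\<bar> ^ j / fact j) * y ^ (k + j)"
        using that by (simp add: abs_mult power_abs power_add)
      also have "\<dots> \<le> \<bar>\<theta>\<bar> ^ k / fact k * (\<bar>\<theta>\<bar> ^ j / fact j)"
        using that by (intro mult_left_le power_le_one) auto
      finally show ?thesis .
    qed
    show "summable (\<lambda>j. \<bar>\<theta>\<bar> ^ k / fact k * (\<bar>\<theta>\<bar> ^ j / fact j))"
      using sums_exp by (intro summable_mult) (rule sums_summable)
  qed (auto simp: poisson_mass_def)
  then show ?thesis
    using assms by (simp add: integral_beta1_monomial mult_ac)
qed

text \<open>The mean of the conditional probability given \<open>Y\<close> is the probability
  itself; transported to the law of \<open>Y\<close>, it is an integral over
  \<open>beta1 \<gamma>\<close>.\<close>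

lemma mixed_poisson_mass_eq_prob:
  assumes "prob_space M" and X: "X \<in> measurable M (count_space UNIV)"
    and Y: "distributed M lborel Y
      (\<lambda>y. ennreal (indicator {0<..<1} y * (\<gamma> * (1 - y) powr (\<gamma> - 1))))"
    and "cond_poisson M X Y (\<lambda>y. \<theta> * y)"
  shows "measure M {\<omega> \<in> space M. X \<omega> = n} = mixed_poisson_mass \<theta> \<gamma> n"
proof -
  interpret prob_space M by fact
  have Ym [measurable]: "Y \<in> borel_measurable M"
    using Y by (simp add: distributed_def)
  let ?F = "vimage_algebra (space M) Y borel"
  have "subalgebra M ?F"
    unfolding subalgebra_def using Ym
    by (auto simp: sets_vimage_algebra2 intro: measurable_sets)
  then interpret finite_measure_subalgebra M ?F
    by unfold_locales
  have [measurable]: "{\<omega> \<in> space M. X \<omega> = n} \<in> sets M"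
    using measurable_sets[OF X, of "{n}"] by (simp add: vimage_def Int_def conj_commute)
  have "measure M {\<omega> \<in> space M. X \<omega> = n} = (\<integral>\<omega>. indicator {\<omega> \<in> space M. X \<omega> = n} \<omega> \<partial>M)"
    by simp
  also have "\<dots> = (\<integral>\<omega>. real_cond_exp M ?F (indicator {\<omega> \<in> space M. X \<omega> = n}) \<omega> \<partial>M)"
    by (rule real_cond_exp_int(2)[symmetric]) (auto intro!: integrable_real_indicator simp: emeasure_eq_measure)
  also have "\<dots> = (\<integral>\<omega>. poisson_mass (\<theta> * Y \<omega>) n \<partial>M)"
    using assms(4) unfolding cond_poisson_def
    by (intro integral_cong_AE) (auto simp: poisson_mass_def)
  also have "\<dots> = (\<integral>y. poisson_mass (\<theta> * y) n \<partial>distr M lborel Y)"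
    by (subst integral_distr) (auto simp: poisson_mass_def)
  also have "\<dots> = mixed_poisson_mass \<theta> \<gamma> n"
    using Y by (simp add: distributed_def mixed_poisson_mass_def beta1_def)
  finally show ?thesis .
qed

section \<open>Generating functions of distributions on the natural numbers\<close>

lemma pgf_sums:
  fixes p :: "nat pmf"
  assumes "\<bar>z\<bar> \<le> (1::real)"
  shows "(\<lambda>n. pmf p n * z ^ n) sums measure_pmf.expectation p (\<lambda>n. z ^ n)"
proof -
  have "integrable (measure_pmf p) (\<lambda>n. z ^ n)"
    using assms by (intro measure_pmf.integrable_const_bound[where B = 1])
      (auto simp: power_abs power_le_one)
  then have "integrable (count_space UNIV) (\<lambda>n. pmf p n * z ^ n)"
    by (simp add: measure_pmf_eq_density integrable_real_density)
  from sums_integral_count_space_nat[OF this] show ?thesis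
    by (simp add: measure_pmf_eq_density integral_real_density)
qed

text \<open>Once the coefficients below \<open>m\<close> vanish, dividing by \<open>z ^ m\<close>
  leaves a power series with constant term \<open>d m\<close>; it is continuous at 0 and vanishes to
  the right of 0.\<close>

lemma powser_eq_0_right_nhd:
  fixes d :: "nat \<Rightarrow> real"
  assumes sums: "\<And>z. 0 < z \<Longrightarrow> z < r \<Longrightarrow> (\<lambda>n. d n * z ^ n) sums 0" and r: "r > 0"
  shows "d m = 0"
proof (induction m rule: less_induct)
  case (less m)
  have s: "(\<lambda>n. d (n + m) * z ^ n) sums 0" if "0 < z" "z < r" for z
  proof -
    have "(\<lambda>n. d (n + m) * z ^ (n + m)) sums 0"
      using sums[OF that] less by (subst sums_zero_iff_shift) auto
    then have "(\<lambda>n. d (n + m) * z ^ (n + m) / z ^ m) sums (0 / z ^ m)"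
      by (rule sums_divide)
    then show ?thesis using that by (simp add: power_add)
  qed
  define g where "g z = (\<Sum>n. d (n + m) * z ^ n)" for z
  have "isCont g 0"
    unfolding g_def
    by (rule isCont_powser[of _ "r / 2"]) (use s[of "r / 2"] r in \<open>auto intro: sums_summable\<close>)
  then have "(g \<longlongrightarrow> g 0) (at_right 0)"
    unfolding isCont_def by (rule filterlim_at_split[THEN iffD1, THEN conjunct2])
  moreover have "eventually (\<lambda>z. g z = 0) (at_right 0)"
    using eventually_at_right_real[OF r] by eventually_elim (use s in \<open>auto simp: g_def sums_iff\<close>)
  then have "(g \<longlongrightarrow> 0) (at_right 0)"
    by (rule tendsto_eventually)
  ultimately have "g 0 = 0"
    by (intro tendsto_unique) auto
  then show ?case by (simp add: g_def)
qed

lemma pmf_eq_if_pgf_eq: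
  fixes p q :: "nat pmf"
  assumes "\<And>z. 0 \<le> z \<Longrightarrow> z \<le> 1 \<Longrightarrow>
    measure_pmf.expectation p (\<lambda>n. z ^ n) = measure_pmf.expectation q (\<lambda>n. z ^ n :: real)"
  shows "p = q"
proof (rule pmf_eqI)
  fix m
  have "(\<lambda>n. (pmf p n - pmf q n) * z ^ n) sums 0" if "0 < z" "z < 1" for z
    using sums_diff[OF pgf_sums[of z p] pgf_sums[of z q]] assms[of z] that by (simp add: left_diff_distrib)
  from powser_eq_0_right_nhd[of 1, OF this] show "pmf p m = pmf q m" by simp
qed

text \<open>The generating function takes the value 1 at \<open>z = 1\<close>, so the masses form a
  distribution.\<close>

lemma mixed_poisson_exists:
  assumes "\<theta> \<ge> 0" "\<gamma> > 0"
  obtains p where "\<And>k. pmf p k = mixed_poisson_mass \<theta> \<gamma> k"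
    "\<And>z. 0 \<le> z \<Longrightarrow> z \<le> 1 \<Longrightarrow> measure_pmf.expectation p (\<lambda>n. z ^ n) =
      exp (- (\<theta> * (1 - z))) * beta1_mgf \<gamma> (\<theta> * (1 - z))"
proof -
  have "mixed_poisson_mass \<theta> \<gamma> sums 1"
    using mixed_poisson_mass_pgf[OF assms, of 1] assms by (simp add: beta1_mgf_def measure_beta1_UNIV)
  then have "(\<integral>\<^sup>+k. ennreal (mixed_poisson_mass \<theta> \<gamma> k) \<partial>count_space UNIV) = 1"
    using mixed_poisson_mass_nonneg[OF assms(1)]
    by (simp add: nn_integral_count_space_nat suminf_ennreal2 sums_iff)
  then have pmf: "pmf (embed_pmf (mixed_poisson_mass \<theta> \<gamma>)) k = mixed_poisson_mass \<theta> \<gamma> k" for k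
    using mixed_poisson_mass_nonneg[OF assms(1)] by (intro pmf_embed_pmf)
  show ?thesis
  proof (rule that[OF pmf])
    fix z :: real assume z: "0 \<le> z" "z \<le> 1"
    with pgf_sums[of z "embed_pmf (mixed_poisson_mass \<theta> \<gamma>)"] mixed_poisson_mass_pgf[OF assms z(1)]
    show "measure_pmf.expectation (embed_pmf (mixed_poisson_mass \<theta> \<gamma>)) (\<lambda>n. z ^ n) =
        exp (- (\<theta> * (1 - z))) * beta1_mgf \<gamma> (\<theta> * (1 - z))"
      by (simp add: pmf sums_iff)
  qed
qed

subsection \<open>Expectations over discrete distributions\<close>

lemma expectation_bind_pmf:
  fixes f :: "'b \<Rightarrow> real"
  assumes "\<And>x. \<bar>f x\<bar> \<le> B"
  shows "measure_pmf.expectation (bind_pmf p K) f =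
    measure_pmf.expectation p (\<lambda>x. measure_pmf.expectation (K x) f)"
  unfolding measure_pmf_bind
  by (rule integral_bind[where K = "count_space UNIV" and B = B and B' = 1])
     (use assms in \<open>auto simp: measure_pmf.finite_measure_axioms measure_pmf_in_subprob_algebra measure_pmf.emeasure_space_1\<close>)

lemma integrable_pmf_bounded:
  fixes f :: "'a \<Rightarrow> real"
  assumes "\<And>x. \<bar>f x\<bar> \<le> B"
  shows "integrable (measure_pmf p) f"
  using assms by (intro measure_pmf.integrable_const_bound[where B = B]) auto

lemma abs_expectation_pmf_le:
  fixes f :: "'a \<Rightarrow> real"
  assumes "\<And>x. \<bar>f x\<bar> \<le> B"
  shows "\<bar>measure_pmf.expectation p f\<bar> \<le> B"
proof -
  have "\<bar>measure_pmf.expectation p f\<bar> \<le> measure_pmf.expectation p (\<lambda>x. \<bar>f x\<bar>)"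
    by (rule integral_abs_bound)
  also have "\<dots> \<le> measure_pmf.expectation p (\<lambda>x. B)"
    using assms order_trans[OF abs_ge_zero assms]
    by (intro integral_mono integrable_pmf_bounded[where B = B]) auto
  finally show ?thesis by simp
qed

text \<open>Meant for the law after a short time, with \<open>F\<close> the starting state or that
  state together with those one jump away: the mass outside \<open>F\<close> is then small, and the
  error is small uniformly in \<open>w\<close>.\<close>

lemma expectation_pmf_split:
  fixes w :: "'a \<Rightarrow> real"
  assumes "finite F" "\<And>x. \<bar>w x\<bar> \<le> B"
  shows "\<bar>measure_pmf.expectation p w - (\<Sum>k\<in>F. pmf p k * w k)\<bar> \<le> B * (1 - (\<Sum>k\<in>F. pmf p k))"
proof -
  have "B \<ge> 0" using assms(2)[of undefined] by linarith
  have F: "measure_pmf.expectation p (\<lambda>x. indicator F x * f x) = (\<Sum>k\<in>F. pmf p k * f k)" for f :: "'a \<Rightarrow> real"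
    using assms(1)
    by (subst integral_measure_pmf_real[of F]) (auto simp: indicator_def mult_ac intro!: sum.cong split: if_splits)
  have int: "integrable (measure_pmf p) w"
    using assms(2) by (rule integrable_pmf_bounded)
  have intF: "integrable (measure_pmf p) (\<lambda>x. indicator F x * w x)"
    using assms(2) \<open>B \<ge> 0\<close> by (intro integrable_pmf_bounded[where B = B]) (auto simp: indicator_def)
  \<comment> \<open>The factor 1 keeps this an instance of the shape in \<open>F\<close>, for the
    constant function 1; the final simplification spares it for the same reason.\<close>
  have intF1: "integrable (measure_pmf p) (\<lambda>x. indicator F x * 1 :: real)"
    by (intro integrable_pmf_bounded[where B = 1]) (auto simp: indicator_def)
  have "measure_pmf.expectation p w - (\<Sum>k\<in>F. pmf p k * w k) =
      measure_pmf.expectation p (\<lambda>x. w x - indicator F x * w x)"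
    using int intF by (simp add: F)
  also have "\<bar>\<dots>\<bar> \<le> measure_pmf.expectation p (\<lambda>x. \<bar>w x - indicator F x * w x\<bar>)"
    by (rule integral_abs_bound)
  also have "\<dots> \<le> measure_pmf.expectation p (\<lambda>x. B * (1 - indicator F x * 1))"
    using assms(2) int intF intF1 by (intro integral_mono) (auto simp: indicator_def)
  also have "\<dots> = B * (1 - (\<Sum>k\<in>F. pmf p k))"
    using intF1 F[of "\<lambda>_. 1"] by (simp del: mult_1_right)
  finally show ?thesis .
qed

subsection \<open>A maximum principle for the backward equation\<close>

text \<open>Let \<open>t0\<close> be the infimum of the times at which some \<open>g i\<close> is
  positive. By continuity none is positive at \<open>t0\<close>; those equal to 0 decrease just
  after it, and the negative ones stay negative. As only indices below \<open>N\<close> matter, one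
  interval to the right of \<open>t0\<close> serves all, a contradiction.\<close>

lemma first_crossing:
  fixes g :: "nat \<Rightarrow> real \<Rightarrow> real"
  assumes cont: "\<And>i. continuous_on {0..} (g i)"
    and init: "\<And>i. g i 0 \<le> 0"
    and large: "\<And>i t. 0 \<le> t \<Longrightarrow> i \<ge> N \<Longrightarrow> g i t \<le> 0"
    and deriv: "\<And>i t. 0 \<le> t \<Longrightarrow> (\<And>k. g k t \<le> 0) \<Longrightarrow> g i t = 0 \<Longrightarrow>
      \<exists>d<0. ((\<lambda>h. g i (t + h)) has_real_derivative d) (at 0 within {0..})"
    and "0 \<le> t"
  shows "g i t \<le> 0"
proof (rule ccontr)
  assume "\<not> g i t \<le> 0"
  define S where "S = {t. 0 \<le> t \<and> (\<exists>i. g i t > 0)}"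
  have "t \<in> S" using \<open>\<not> g i t \<le> 0\<close> \<open>0 \<le> t\<close> by (auto simp: S_def not_le)
  then have S: "S \<noteq> {}" "bdd_below S"
    by (auto simp: S_def intro!: bdd_belowI[of _ 0])
  define t0 where "t0 = Inf S"
  have "0 \<le> t0" unfolding t0_def using S by (intro cInf_greatest) (auto simp: S_def)
  have before: "g k s \<le> 0" if "0 \<le> s" "s < t0" for k s
  proof (rule ccontr)
    assume "\<not> g k s \<le> 0"
    with that have "s \<in> S" by (auto simp: S_def not_le)
    from cInf_lower[OF this S(2)] that show False by (simp add: t0_def)
  qed
  have t0: "g k t0 \<le> 0" for k
  proof (cases "t0 = 0")
    case False
    with \<open>0 \<le> t0\<close> have cl: "closure {0..<t0} = {0..t0}" by simp
    show ?thesis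
    proof (rule continuous_le_on_closure[where S = "{0..<t0}" and f = "g k" and x = t0])
      show "continuous_on (closure {0..<t0}) (g k)"
        unfolding cl by (rule continuous_on_subset[OF cont]) auto
      show "t0 \<in> closure {0..<t0}" using \<open>0 \<le> t0\<close> unfolding cl by simp
    qed (use before in auto)
  qed (use init in simp)
  have ev: "\<forall>\<^sub>F h in at_right 0. g k (t0 + h) \<le> 0" for k
  proof (cases "g k t0 = 0")
    case True
    from deriv[OF \<open>0 \<le> t0\<close> t0 True] obtain d
      where d: "d < 0" "((\<lambda>h. g k (t0 + h)) has_real_derivative d) (at 0 within {0..})" by blast
    from has_real_derivative_neg_dec_right[OF d(2,1)] obtain e
      where e: "e > 0" "\<And>h. h > 0 \<Longrightarrow> h < e \<Longrightarrow> g k (t0 + h) < g k t0" by auto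
    from eventually_at_right_real[OF e(1)] show ?thesis
      by eventually_elim (use e(2) True in force)
  next
    case False
    with t0[of k] have "g k t0 < 0" by simp
    have "((\<lambda>h. g k (t0 + h)) \<longlongrightarrow> g k (t0 + 0)) (at_right 0)"
      by (rule continuous_on_tendsto_compose[OF cont])
         (use \<open>0 \<le> t0\<close> in \<open>auto intro!: tendsto_eq_intros simp: eventually_at_filter\<close>)
    from order_tendstoD(2)[OF this, of 0] \<open>g k t0 < 0\<close> show ?thesis
      by (auto elim: eventually_mono)
  qed
  have "\<forall>\<^sub>F h in at_right 0. \<forall>k<N. g k (t0 + h) \<le> 0"
    using ev by (simp add: eventually_ball_finite_distrib[of "{..<N}", simplified Ball_def lessThan_iff])
  then obtain e where e: "e > 0" "\<And>h k. 0 < h \<Longrightarrow> h < e \<Longrightarrow> k < N \<Longrightarrow> g k (t0 + h) \<le> 0"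
    unfolding eventually_at_right_field by auto
  have "t0 + e \<le> s" if "s \<in> S" for s
  proof (rule ccontr)
    assume "\<not> t0 + e \<le> s"
    moreover have "t0 \<le> s" unfolding t0_def using that S by (intro cInf_lower) auto
    ultimately have "g k s \<le> 0" for k
      using e(2)[of "s - t0" k] large[of s k] t0[of k] \<open>0 \<le> t0\<close>
      by (cases "s = t0"; cases "k < N") auto
    with that show False by (auto simp: S_def not_less[symmetric])
  qed
  then have "t0 + e \<le> Inf S" using S by (intro cInf_greatest) auto
  with e(1) show False by (simp add: t0_def)
qed

text \<open>At \<open>i = 0\<close> truncated subtraction gives \<open>i - 1 = 0\<close>, but the
  factor \<open>real i\<close> and the difference \<open>f 0 - f i\<close> vanish, so neither
  departure nor reset contributes.\<close>

definition reset_gen :: "real \<Rightarrow> real \<Rightarrow> real \<Rightarrow> (nat \<Rightarrow> real) \<Rightarrow> nat \<Rightarrow> real" where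
  "reset_gen lam \<mu> \<kappa> f i =
    lam * (f (i + 1) - f i) + real i * \<mu> * (f (i - 1) - f i) + \<kappa> * (f 0 - f i)"

text \<open>For \<open>i \<ge> 1\<close> the departure rate is
  \<open>\<mu> + (i - 1) * \<mu> = i * \<mu>\<close>; at \<open>i = 0\<close>, where truncated
  subtraction would leave \<open>\<mu>\<close>, the guard in \<open>reset_queue_rate\<close>
  excludes departures. Hence one analysis covers both queues.\<close>

lemma mm1m_reset_rate_eq_mminf: "mm1m_reset_rate lam \<mu> \<mu> \<kappa> = mminf_reset_rate lam \<mu> \<kappa>"
  by (auto simp: fun_eq_iff mm1m_reset_rate_def mminf_reset_rate_def reset_queue_rate_def
      of_nat_diff algebra_simps)

text \<open>The finite set contains \<open>i\<close> and every state reachable in one jump, so the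
  infinite sum in the diagonal entry becomes finite. Elements coincide when
  \<open>i \<le> 1\<close>, so the sum is split by mechanism, not by target.\<close>

lemma sum_generator_mminf:
  "(\<Sum>k\<in>{0, i - 1, i, i + 1}. generator (mminf_reset_rate lam \<mu> \<kappa>) i k * f k) = reset_gen lam \<mu> \<kappa> f i"
proof -
  let ?r = "mminf_reset_rate lam \<mu> \<kappa>" and ?F = "{0, i - 1, i, i + 1}"
  have "(\<Sum>\<^sub>\<infinity>k\<in>- {i}. ?r i k) = (\<Sum>\<^sub>\<infinity>k\<in>?F - {i}. ?r i k)"
    by (rule infsum_cong_neutral) (auto simp: mminf_reset_rate_def reset_queue_rate_def)
  then have diag: "generator ?r i i = - (\<Sum>k\<in>?F - {i}. ?r i k)"
    by (simp add: generator_def)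
  have "(\<Sum>k\<in>?F. generator ?r i k * f k) =
      generator ?r i i * f i + (\<Sum>k\<in>?F - {i}. generator ?r i k * f k)"
    by (rule sum.remove) auto
  also have "\<dots> = generator ?r i i * f i + (\<Sum>k\<in>?F - {i}. ?r i k * f k)"
    by (intro arg_cong2[where f = "(+)"] refl sum.cong) (auto simp: generator_def)
  also have "\<dots> = (\<Sum>k\<in>?F - {i}. ?r i k * (f k - f i))"
    unfolding diag right_diff_distrib sum_subtractf sum_distrib_right[symmetric] by simp
  also have "\<dots> = (\<Sum>k\<in>?F. ?r i k * (f k - f i))"
    by (rule sum.mono_neutral_left) auto
  also have "\<dots> = (\<Sum>k\<in>?F. if k = i + 1 then lam * (f k - f i) else 0) +
      (\<Sum>k\<in>?F. if k = i - 1 then real i * \<mu> * (f k - f i) else 0) +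
      (\<Sum>k\<in>?F. if k = 0 then \<kappa> * (f k - f i) else 0)"
    unfolding sum.distrib[symmetric]
    by (cases "i = 0"; intro sum.cong) (auto simp: mminf_reset_rate_def reset_queue_rate_def distrib_right)
  also have "\<dots> = reset_gen lam \<mu> \<kappa> f i"
    by (subst (1 2 3) sum.delta) (auto simp: reset_gen_def)
  finally show ?thesis .
qed

text \<open>Nonexplosion enters here, through \<open>reset_gen lam \<mu> \<kappa> (\<lambda>i. 1 + real i) i \<le> lam\<close>.\<close>

lemma backward_solution_le_0:
  assumes rates: "lam \<ge> 0" "\<mu> \<ge> 0" "\<kappa> \<ge> 0"
    and cont: "\<And>i. continuous_on {0..} (D i)"
    and bound: "\<And>i t. 0 \<le> t \<Longrightarrow> D i t \<le> B"
    and init: "\<And>i. D i 0 \<le> 0"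
    and deriv: "\<And>i t. 0 \<le> t \<Longrightarrow> ((\<lambda>h. D i (t + h)) has_real_derivative
      reset_gen lam \<mu> \<kappa> (\<lambda>k. D k t) i) (at 0 within {0..})"
    and "0 \<le> t"
  shows "D i t \<le> 0"
proof -
  \<comment> \<open>\<open>1 + real i\<close> is the Lyapunov function. The growth rate
    \<open>lam + 1\<close> exceeds the drift bound \<open>lam\<close>, which gives strict negativity
    at a contact point; \<epsilon> is removed at the end.\<close>
  have *: "D i t - \<epsilon> * exp ((lam + 1) * t) * (1 + real i) \<le> 0" if "\<epsilon> > 0" for \<epsilon>
  proof -
    define c where "c s = \<epsilon> * exp ((lam + 1) * s)" for s
    define g where "g i s = D i s - c s * (1 + real i)" for i s
    \<comment> \<open>From this index on the penalty alone outweighs the bound \<open>B\<close>,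
      which leaves finitely many states to watch.\<close>
    obtain N where N: "B / \<epsilon> \<le> real N" using real_arch_simple by blast
    have "g i t \<le> 0"
    proof (rule first_crossing[where N = N, OF _ _ _ _ \<open>0 \<le> t\<close>])
      show "continuous_on {0..} (g i)" for i
        unfolding g_def c_def by (intro continuous_intros cont)
      show "g i 0 \<le> 0" for i
        using init[of i] that by (simp add: g_def c_def add_increasing2 order_trans[OF init])
      show "g i s \<le> 0" if s: "0 \<le> s" "N \<le> i" for i s
      proof -
        have "D i s \<le> B" using bound s by simp
        also have "B \<le> \<epsilon> * real N" using N \<open>\<epsilon> > 0\<close> by (simp add: field_simps)
        also have "\<dots> \<le> \<epsilon> * (1 + real i)" using s \<open>\<epsilon> > 0\<close> by simp
        also have "\<dots> \<le> c s * (1 + real i)"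
          unfolding c_def using s \<open>\<epsilon> > 0\<close> rates by (intro mult_right_mono) auto
        finally show ?thesis by (simp add: g_def)
      qed
      show "\<exists>d<0. ((\<lambda>h. g i (s + h)) has_real_derivative d) (at 0 within {0..})"
        if s: "0 \<le> s" "\<And>k. g k s \<le> 0" "g i s = 0" for i s
      proof (intro exI conjI)
        have "c s > 0" using \<open>\<epsilon> > 0\<close> by (simp add: c_def)
        \<comment> \<open>At a contact point \<open>g i s = 0\<close> is the maximum over all
          states, so moving to \<open>k\<close> raises \<open>D\<close> at most by the penalty
          difference. Only an arrival can raise it.\<close>
        have le: "D k s - D i s \<le> c s * (real k - real i)" for k
          using s(2)[of k] s(3) by (simp add: g_def algebra_simps)
        have down: "D k s - D i s \<le> 0" if "k \<le> i" for k
          using le[of k] mult_nonneg_nonpos[of "c s" "real k - real i"] that \<open>c s > 0\<close> by simp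
        have "reset_gen lam \<mu> \<kappa> (\<lambda>k. D k s) i \<le> lam * c s + 0 + 0"
          unfolding reset_gen_def
          by (intro add_mono mult_left_mono mult_nonneg_nonpos down)
             (use le[of "i + 1"] rates in auto)
        also have "\<dots> < (lam + 1) * c s * (1 + real i)"
        proof -
          have "lam * c s < (lam + 1) * c s" using \<open>c s > 0\<close> by simp
          also have "\<dots> \<le> (lam + 1) * c s * (1 + real i)"
            using mult_left_mono[of 1 "1 + real i" "(lam + 1) * c s"] \<open>c s > 0\<close> rates by simp
          finally show ?thesis by simp
        qed
        finally show "reset_gen lam \<mu> \<kappa> (\<lambda>k. D k s) i - (lam + 1) * c s * (1 + real i) < 0"
          by simp
        show "((\<lambda>h. g i (s + h)) has_real_derivative
            (reset_gen lam \<mu> \<kappa> (\<lambda>k. D k s) i - (lam + 1) * c s * (1 + real i))) (at 0 within {0..})"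
          unfolding g_def c_def
          by (intro DERIV_diff deriv s) (auto intro!: derivative_eq_intros simp: mult_ac)
      qed
    qed
    then show ?thesis by (simp add: g_def c_def)
  qed
  show ?thesis
  proof (rule ccontr)
    assume "\<not> D i t \<le> 0"
    then have "D i t > 0" by simp
    define C where "C = exp ((lam + 1) * t) * (1 + real i)"
    have "C > 0" by (simp add: C_def add_pos_nonneg)
    \<comment> \<open>This \<epsilon> makes the penalty half of \<open>D i t\<close>.\<close>
    with *[of "D i t / (2 * C)"] \<open>D i t > 0\<close> show False
      by (simp add: C_def[symmetric] mult.assoc)
  qed
qed

subsection \<open>The transition function of the queue with resetting\<close>

locale reset_queue =
  fixes lam \<mu> \<kappa> :: real and P :: "real \<Rightarrow> nat \<Rightarrow> nat pmf"
  assumes lam: "lam \<ge> 0" and mu: "\<mu> > 0" and kappa: "\<kappa> > 0"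
    and ctmc: "ctmc (mminf_reset_rate lam \<mu> \<kappa>) P"
begin

abbreviation "\<theta> \<equiv> lam / \<mu>"
abbreviation "\<gamma> \<equiv> \<kappa> / \<mu>"
abbreviation "Q \<equiv> reset_gen lam \<mu> \<kappa>"

lemma gamma_pos: "\<gamma> > 0" and theta_nonneg: "\<theta> \<ge> 0"
  using lam mu kappa by auto

lemma P_0: "P 0 i = return_pmf i"
  using ctmc by (simp add: ctmc_def)

lemma P_add: "0 \<le> s \<Longrightarrow> 0 \<le> t \<Longrightarrow> P (s + t) i = bind_pmf (P s i) (P t)"
  using ctmc by (simp add: ctmc_def)

lemma P_deriv: "((\<lambda>t. pmf (P t i) j) has_real_derivative
    generator (mminf_reset_rate lam \<mu> \<kappa>) i j) (at 0 within {0..})"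
  using ctmc by (simp add: ctmc_def)

text \<open>Conditioning on the first \<open>h\<close> units of time gives a mean under
  \<open>P h i\<close> of the bounded function \<open>w\<close>. Its part on the states within one
  jump is a finite sum, differentiated term by term; the rest is at most \<open>B\<close> times the
  mass outside, which is of smaller order than \<open>h\<close> because the generator row sums to
  zero over these states.\<close>

lemma backward_equation:
  assumes f: "\<And>x. \<bar>f x\<bar> \<le> B" and t: "0 \<le> t"
  shows "((\<lambda>h. measure_pmf.expectation (P (t + h) i) f) has_real_derivative
    Q (\<lambda>k. measure_pmf.expectation (P t k) f) i) (at 0 within {0..})"
proof -
  define w where "w k = measure_pmf.expectation (P t k) f" for k
  define F where "F = {0, i - 1, i, i + 1}"
  define R where "R h = measure_pmf.expectation (P h i) w - (\<Sum>k\<in>F. pmf (P h i) k * w k)" for h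
  define m where "m h = 1 - (\<Sum>k\<in>F. pmf (P h i) k)" for h
  have w: "\<bar>w k\<bar> \<le> B" for k
    unfolding w_def using f by (rule abs_expectation_pmf_le)
  have R: "\<bar>R h\<bar> \<le> B * m h" for h
    unfolding R_def m_def using w by (intro expectation_pmf_split) (auto simp: F_def)
  have m0: "m 0 = 0"
    by (simp add: m_def P_0 F_def pmf_return indicator_def)
  have "(m has_real_derivative 0 - (\<Sum>k\<in>F. generator (mminf_reset_rate lam \<mu> \<kappa>) i k)) (at 0 within {0..})"
    unfolding m_def by (intro DERIV_diff DERIV_const DERIV_sum P_deriv)
  also have "(\<Sum>k\<in>F. generator (mminf_reset_rate lam \<mu> \<kappa>) i k) = 0"
    using sum_generator_mminf[of lam \<mu> \<kappa> i "\<lambda>_. 1"] unfolding F_def by (simp add: reset_gen_def)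
  finally have "((\<lambda>h. m h / h) \<longlongrightarrow> 0) (at 0 within {0..})"
    by (simp add: has_field_derivative_iff m0)
  then have "((\<lambda>h. B * \<bar>m h / h\<bar>) \<longlongrightarrow> 0) (at 0 within {0..})"
    by (intro tendsto_mult_right_zero tendsto_rabs_zero)
  moreover have "\<forall>\<^sub>F h in at 0 within {0..}. norm (R h / h) \<le> B * \<bar>m h / h\<bar>"
  proof (rule always_eventually, rule allI)
    fix h
    have "B \<ge> 0" using w[of 0] by linarith
    then have "\<bar>R h\<bar> \<le> B * \<bar>m h\<bar>"
      using R[of h] mult_left_mono[of "m h" "\<bar>m h\<bar>" B] by linarith
    then show "norm (R h / h) \<le> B * \<bar>m h / h\<bar>"
      using divide_right_mono[of _ _ "\<bar>h\<bar>"] by (simp add: abs_divide)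
  qed
  ultimately have "((\<lambda>h. R h / h) \<longlongrightarrow> 0) (at 0 within {0..})"
    by (rule Lim_null_comparison[rotated])
  moreover have "R 0 = 0" using R[of 0] m0 by simp
  ultimately have "(R has_real_derivative 0) (at 0 within {0..})"
    by (simp add: has_field_derivative_iff)
  then have "((\<lambda>h. R h + (\<Sum>k\<in>F. pmf (P h i) k * w k)) has_real_derivative
      0 + (\<Sum>k\<in>F. generator (mminf_reset_rate lam \<mu> \<kappa>) i k * w k)) (at 0 within {0..})"
    by (intro DERIV_add DERIV_sum DERIV_cmult_right P_deriv)
  then have "((\<lambda>h. measure_pmf.expectation (P h i) w) has_real_derivative Q w i) (at 0 within {0..})"
    unfolding R_def F_def sum_generator_mminf by simp
  then show ?thesis
    unfolding w_def
  proof (rule has_field_derivative_transform_within[OF _ zero_less_one])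
    fix h :: real assume "h \<in> {0..}"
    then show "measure_pmf.expectation (P h i) (\<lambda>k. measure_pmf.expectation (P t k) f) =
        measure_pmf.expectation (P (t + h) i) f"
      using t f by (simp add: add.commute[of t] P_add expectation_bind_pmf[of f B])
  qed simp
qed

text \<open>The backward equation gives right derivatives only, whereas the maximum principle asks
  for continuity from both sides. The modulus \<open>2 * B * m h\<close> does not depend on the base
  time, so it also controls times before \<open>t\<close>.\<close>

lemma continuous_on_expectation:
  fixes f :: "nat \<Rightarrow> real"
  assumes f: "\<And>x. \<bar>f x\<bar> \<le> B"
  shows "continuous_on {0..} (\<lambda>t. measure_pmf.expectation (P t i) f)"
proof -
  define u where "u t k = measure_pmf.expectation (P t k) f" for t k
  define m where "m h = 1 - pmf (P h i) i" for h
  have u: "\<bar>u t k\<bar> \<le> B" for t k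
    unfolding u_def using f by (rule abs_expectation_pmf_le)
  have diff: "\<bar>u (t + h) i - u t i\<bar> \<le> 2 * B * m h" if "0 \<le> t" "0 \<le> h" for t h
  proof -
    have "u (t + h) i = measure_pmf.expectation (P h i) (u t)"
      unfolding u_def using that f by (simp add: add.commute[of t] P_add expectation_bind_pmf[of f B])
    moreover have "\<bar>measure_pmf.expectation (P h i) (u t) - pmf (P h i) i * u t i\<bar> \<le> B * m h"
      using expectation_pmf_split[of "{i}" "u t" B "P h i"] u by (simp add: m_def)
    moreover have "\<bar>m h * u t i\<bar> \<le> m h * B"
      unfolding abs_mult using u[of t i] by (intro mult_mono) (auto simp: m_def pmf_le_1)
    ultimately show ?thesis by (simp add: m_def algebra_simps)
  qed
  have "((\<lambda>h. pmf (P h i) i) \<longlongrightarrow> pmf (P 0 i) i) (at 0 within {0..})"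
    using DERIV_continuous[OF P_deriv] by (simp add: continuous_within)
  then have "((\<lambda>h. 2 * B * m h) \<longlongrightarrow> 2 * B * (1 - 1)) (at 0 within {0..})"
    unfolding m_def by (intro tendsto_intros) (simp add: P_0)
  then have lim: "((\<lambda>h. 2 * B * m h) \<longlongrightarrow> 0) (at 0 within {0..})" by simp
  have "\<exists>d>0. \<forall>s\<in>{0..}. dist s t < d \<longrightarrow> dist (u s i) (u t i) < e" if "0 \<le> t" "e > 0" for t e
  proof -
    from tendstoD[OF lim \<open>e > 0\<close>] obtain d
      where d: "d > 0" "\<And>h. 0 < h \<Longrightarrow> h < d \<Longrightarrow> \<bar>2 * B * m h\<bar> < e"
      by (auto simp: eventually_at)
    have "\<bar>u s i - u t i\<bar> < e" if s: "0 \<le> s" "\<bar>s - t\<bar> < d" for s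
      using diff[of s "t - s"] diff[of t "s - t"] d(2)[of "\<bar>s - t\<bar>"] s \<open>0 \<le> t\<close> \<open>e > 0\<close>
      by (cases s t rule: linorder_cases) auto
    then show ?thesis using d(1) by (auto simp: dist_real_def)
  qed
  then show ?thesis
    unfolding continuous_on_iff u_def by auto
qed

text \<open>
  With \<open>K = pgf_reset_loss\<close> and \<open>G = pgf_no_reset\<close>, the contribution of at least one reset, the integral of
  \<open>\<kappa> exp (- \<kappa> s) G z 0 s\<close> over \<open>0 \<le> s \<le> t\<close>, is written as \<open>pgf_limit z - K z t\<close>. The differential
  equation for \<open>beta1_mgf\<close> is what makes \<open>K\<close> the tail of that integral.
\<close>

definition pgf_limit :: "real \<Rightarrow> real" where
  "pgf_limit z = exp (- (\<theta> * (1 - z))) * beta1_mgf \<gamma> (\<theta> * (1 - z))"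

definition pgf_reset_loss :: "real \<Rightarrow> real \<Rightarrow> real" where
  "pgf_reset_loss z t = exp (- (\<kappa> * t)) * exp (- (\<theta> * (1 - z))) *
    beta1_mgf \<gamma> (\<theta> * (1 - z) * exp (- (\<mu> * t)))"

text \<open>The generating function of the M/M/\<infinity> queue: each of the \<open>i\<close>
  initial customers is still present independently with probability
  \<open>exp (- (\<mu> * t))\<close>, and the newcomers still present are Poisson with mean
  \<open>\<theta> * (1 - exp (- (\<mu> * t)))\<close>.\<close>

definition pgf_no_reset :: "real \<Rightarrow> nat \<Rightarrow> real \<Rightarrow> real" where
  "pgf_no_reset z i t = (1 - (1 - z) * exp (- (\<mu> * t))) ^ i *
    exp (- (\<theta> * (1 - z) * (1 - exp (- (\<mu> * t)))))"

definition pgf_transient :: "real \<Rightarrow> nat \<Rightarrow> real \<Rightarrow> real" where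
  "pgf_transient z i t = pgf_limit z - pgf_reset_loss z t + exp (- (\<kappa> * t)) * pgf_no_reset z i t"

lemma pgf_reset_loss_deriv:
  "(pgf_reset_loss z has_real_derivative - (\<kappa> * exp (- (\<kappa> * t)) * pgf_no_reset z 0 t)) (at t)"
proof -
  define x where "x = \<theta> * (1 - z)"
  define y where "y = x * exp (- (\<mu> * t))"
  obtain D where D: "(beta1_mgf \<gamma> has_real_derivative D) (at y)"
    "y * D + \<gamma> * beta1_mgf \<gamma> y = \<gamma> * exp y"
    using beta1_mgf_ode[OF gamma_pos] by blast
  \<comment> \<open>Multiplying by \<mu> turns \<gamma> into \<kappa>.\<close>
  have ode: "\<mu> * (y * D) + \<kappa> * beta1_mgf \<gamma> y = \<kappa> * exp y"
    using arg_cong[OF D(2), of "\<lambda>v. \<mu> * v"] mu by (simp add: distrib_left)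
  have "((\<lambda>t. x * exp (- (\<mu> * t))) has_real_derivative - (\<mu> * y)) (at t)"
    unfolding y_def by (auto intro!: derivative_eq_intros)
  from DERIV_chain2[OF D(1)[unfolded y_def] this]
  have "((\<lambda>t. beta1_mgf \<gamma> (x * exp (- (\<mu> * t)))) has_real_derivative - (\<mu> * (y * D))) (at t)"
    by (simp add: mult_ac)
  then have "((\<lambda>t. exp (- (\<kappa> * t)) * exp (- x) * beta1_mgf \<gamma> (x * exp (- (\<mu> * t)))) has_real_derivative
      - (exp (- (\<kappa> * t)) * exp (- x) * (\<mu> * (y * D) + \<kappa> * beta1_mgf \<gamma> y))) (at t)"
    by (auto intro!: derivative_eq_intros simp: y_def algebra_simps)
  moreover have N: "pgf_no_reset z 0 t = exp (- x) * exp y"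
    by (simp add: pgf_no_reset_def exp_add[symmetric] y_def x_def algebra_simps diff_divide_distrib add_divide_distrib)
  ultimately show ?thesis
    unfolding ode N pgf_reset_loss_def[abs_def] x_def[symmetric] by (simp add: mult_ac)
qed

text \<open>The subtraction strips the reset term from \<open>Q\<close>. What remains comes from
  \<open>p' = \<mu> * (1 - p)\<close> and \<open>q' = - lam * (1 - p) * q\<close> for the base
  \<open>p\<close> of the power and the exponential factor \<open>q\<close>.\<close>

lemma pgf_no_reset_deriv:
  "(pgf_no_reset z i has_real_derivative
    (Q (\<lambda>k. pgf_no_reset z k t) i - \<kappa> * (pgf_no_reset z 0 t - pgf_no_reset z i t))) (at t)"
proof -
  define p where "p s = 1 - (1 - z) * exp (- (\<mu> * s))" for s
  define q where "q s = exp (- (\<theta> * (1 - z) * (1 - exp (- (\<mu> * s)))))" for s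
  have p: "(p has_real_derivative \<mu> * (1 - p t)) (at t)"
    unfolding p_def by (auto intro!: derivative_eq_intros)
  have q: "(q has_real_derivative - (lam * (1 - p t) * q t)) (at t)"
    unfolding q_def p_def using mu by (auto intro!: derivative_eq_intros)
  have "((\<lambda>s. p s ^ i * q s) has_real_derivative
      (real i * (\<mu> * (1 - p t) * p t ^ (i - 1)) * q t - p t ^ i * (lam * (1 - p t) * q t))) (at t)"
    using DERIV_mult[OF DERIV_power[OF p] q] by (simp add: mult_ac)
  moreover have "real i * (\<mu> * (1 - p t) * p t ^ (i - 1)) * q t - p t ^ i * (lam * (1 - p t) * q t) =
      lam * (p t ^ (i + 1) * q t - p t ^ i * q t) + real i * \<mu> * (p t ^ (i - 1) * q t - p t ^ i * q t)"
    by (cases i) (simp_all add: algebra_simps)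
  ultimately show ?thesis
    unfolding pgf_no_reset_def[abs_def] reset_gen_def p_def[symmetric] q_def[symmetric] by simp
qed

text \<open>\<open>Q\<close> annihilates the terms free of \<open>i\<close>. The derivatives of the
  loss and of \<open>exp (- (\<kappa> * t))\<close> together supply the reset term missing in
  \<open>pgf_no_reset_deriv\<close>.\<close>

lemma pgf_transient_deriv:
  "(pgf_transient z i has_real_derivative Q (\<lambda>k. pgf_transient z k t) i) (at t)"
proof -
  define N where "N k = pgf_no_reset z k t" for k
  define e where "e = exp (- (\<kappa> * t))"
  have "((\<lambda>t. exp (- (\<kappa> * t))) has_real_derivative - (\<kappa> * e)) (at t)"
    unfolding e_def by (auto intro!: derivative_eq_intros)
  from DERIV_add[OF DERIV_diff[OF DERIV_const pgf_reset_loss_deriv] DERIV_mult[OF this pgf_no_reset_deriv]]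
  have "(pgf_transient z i has_real_derivative
      (0 - - (\<kappa> * e * N 0) + (- (\<kappa> * e) * N i + (Q N i - \<kappa> * (N 0 - N i)) * e))) (at t)"
    unfolding pgf_transient_def[abs_def] N_def e_def .
  moreover have "Q (\<lambda>k. pgf_transient z k t) i = e * Q N i"
    unfolding pgf_transient_def N_def[symmetric] e_def[symmetric] reset_gen_def by (simp add: algebra_simps)
  ultimately show ?thesis by (simp add: algebra_simps)
qed

lemma pgf_transient_0: "pgf_transient z i 0 = z ^ i"
  by (simp add: pgf_transient_def pgf_limit_def pgf_reset_loss_def pgf_no_reset_def)

text \<open>The loss and the no-reset term are both \<open>exp (- (\<kappa> * t))\<close> times a
  number between 0 and 1. The bound is uniform in \<open>i\<close>, so it can be integrated against
  any initial distribution.\<close>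

lemma pgf_transient_dist:
  assumes "0 \<le> z" "z \<le> 1" "0 \<le> t"
  shows "\<bar>pgf_transient z i t - pgf_limit z\<bar> \<le> exp (- (\<kappa> * t))"
proof -
  define x where "x = \<theta> * (1 - z)"
  define y where "y = x * exp (- (\<mu> * t))"
  have "0 \<le> x" unfolding x_def using theta_nonneg assms by (intro mult_nonneg_nonneg) auto
  moreover have E: "exp (- (\<mu> * t)) \<le> 1" using mu assms by simp
  ultimately have y: "0 \<le> y" "y \<le> x" unfolding y_def by (auto intro!: mult_left_le)
  have "beta1_mgf \<gamma> y \<le> exp y" "0 \<le> beta1_mgf \<gamma> y"
    using beta1_mgf_bounds[OF gamma_pos y(1)] by auto
  then have "0 \<le> exp (- x) * beta1_mgf \<gamma> y" "exp (- x) * beta1_mgf \<gamma> y \<le> exp (- x) * exp x"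
    using y by (auto intro!: mult_left_mono intro: order_trans)
  then have loss: "0 \<le> exp (- x) * beta1_mgf \<gamma> y" "exp (- x) * beta1_mgf \<gamma> y \<le> 1"
    by (simp_all add: exp_add[symmetric])
  have "(1 - z) * exp (- (\<mu> * t)) \<le> 1"
    using assms E by (intro mult_le_one) auto
  moreover have "0 \<le> x * (1 - exp (- (\<mu> * t)))"
    using \<open>0 \<le> x\<close> E by simp
  ultimately have nr: "0 \<le> pgf_no_reset z i t" "pgf_no_reset z i t \<le> 1"
    using assms unfolding pgf_no_reset_def x_def[symmetric]
    by (auto intro!: mult_le_one power_le_one)
  have "pgf_transient z i t - pgf_limit z = exp (- (\<kappa> * t)) * (pgf_no_reset z i t - exp (- x) * beta1_mgf \<gamma> y)"
    by (simp add: pgf_transient_def pgf_reset_loss_def x_def y_def right_diff_distrib mult.assoc)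
  also have "\<bar>\<dots>\<bar> \<le> exp (- (\<kappa> * t))"
    unfolding abs_mult using loss nr by (auto intro!: mult_left_le)
  finally show ?thesis .
qed

text \<open>The difference of both sides is a bounded solution of the backward equation with zero
  initial values; the maximum principle applies to it and to its negative.\<close>

lemma expectation_power_eq_pgf_transient:
  assumes z: "0 \<le> z" "z \<le> 1" and "0 \<le> t"
  shows "measure_pmf.expectation (P t i) (\<lambda>n. z ^ n) = pgf_transient z i t"
proof -
  define u where "u i t = measure_pmf.expectation (P t i) (\<lambda>n. z ^ n)" for i t
  define D where "D i t = u i t - pgf_transient z i t" for i t
  have pow: "\<bar>z ^ n\<bar> \<le> 1" for n using z by (simp add: power_le_one)
  have u: "\<bar>u i t\<bar> \<le> 1" for i t
    unfolding u_def using pow by (rule abs_expectation_pmf_le)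
  have bound: "\<bar>D i t\<bar> \<le> 2 + \<bar>pgf_limit z\<bar>" if "0 \<le> t" for i t
  proof -
    have "exp (- (\<kappa> * t)) \<le> 1" using kappa that by simp
    then show ?thesis
      using u[of i t] pgf_transient_dist[OF z that, of i] unfolding D_def by linarith
  qed
  have cont: "continuous_on {0..} (D i)" for i
  proof -
    have "continuous_on {0..} (pgf_transient z i)"
      by (rule DERIV_continuous_on, rule has_field_derivative_at_within, rule pgf_transient_deriv)
    then show ?thesis
      unfolding D_def u_def by (intro continuous_on_diff continuous_on_expectation[OF pow])
  qed
  have init: "D i 0 = 0" for i
    by (simp add: D_def u_def P_0 pgf_transient_0)
  have deriv: "((\<lambda>h. D i (t + h)) has_real_derivative Q (\<lambda>k. D k t) i) (at 0 within {0..})"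
    if "0 \<le> t" for i t
  proof -
    have "((\<lambda>h. pgf_transient z i (t + h)) has_real_derivative Q (\<lambda>k. pgf_transient z k t) i) (at 0)"
      using pgf_transient_deriv[of z i t] DERIV_shift[of "pgf_transient z i" _ 0 t]
      by (simp add: add.commute)
    from DERIV_diff[OF backward_equation[OF pow that] has_field_derivative_at_within[OF this]]
    have "((\<lambda>h. D i (t + h)) has_real_derivative Q (\<lambda>k. u k t) i - Q (\<lambda>k. pgf_transient z k t) i)
        (at 0 within {0..})"
      unfolding D_def u_def .
    also have "Q (\<lambda>k. u k t) i - Q (\<lambda>k. pgf_transient z k t) i = Q (\<lambda>k. D k t) i"
      by (simp add: reset_gen_def D_def algebra_simps)
    finally show ?thesis .
  qed
  have rates: "lam \<ge> 0" "\<mu> \<ge> 0" "\<kappa> \<ge> 0" using lam mu kappa by auto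
  have "D i t \<le> 0"
    using bound init
    by (intro backward_solution_le_0[OF rates cont _ _ deriv \<open>0 \<le> t\<close>, of "2 + \<bar>pgf_limit z\<bar>"])
       (auto dest: abs_le_D1)
  moreover have "- D i t \<le> 0"
  proof (rule backward_solution_le_0[OF rates _ _ _ _ \<open>0 \<le> t\<close>, of "\<lambda>i t. - D i t" "2 + \<bar>pgf_limit z\<bar>"])
    show "continuous_on {0..} (\<lambda>t. - D i t)" for i
      by (intro continuous_on_minus cont)
    show "((\<lambda>h. - D i (t + h)) has_real_derivative Q (\<lambda>k. - D k t) i) (at 0 within {0..})"
      if "0 \<le> t" for i t
      using DERIV_minus[OF deriv[OF that, of i]] by (simp add: reset_gen_def algebra_simps)
  qed (use bound init in \<open>auto dest: abs_le_D2\<close>)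
  ultimately show ?thesis by (simp add: D_def u_def)
qed

text \<open>Stationarity at every \<open>t\<close> allows integrating
  \<open>pgf_transient_dist\<close> against \<open>\<pi>\<close>; the deviation from the limit is
  then at most \<open>exp (- (\<kappa> * t))\<close> for all \<open>t \<ge> 0\<close>, hence zero.
  This yields uniqueness.\<close>

lemma stationary_pgf:
  assumes "stationary_distribution P \<pi>" and z: "0 \<le> z" "z \<le> 1"
  shows "measure_pmf.expectation \<pi> (\<lambda>n. z ^ n) = pgf_limit z"
proof -
  have pow: "\<bar>z ^ n\<bar> \<le> 1" for n using z by (simp add: power_le_one)
  define c where "c = measure_pmf.expectation \<pi> (\<lambda>n. z ^ n) - pgf_limit z"
  have "\<bar>c\<bar> \<le> exp (- (\<kappa> * t))" if "0 \<le> t" for t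
  proof -
    have dist: "\<bar>pgf_transient z i t - pgf_limit z\<bar> \<le> exp (- (\<kappa> * t))" for i
      using pgf_transient_dist z that .
    then have "integrable (measure_pmf \<pi>) (\<lambda>i. pgf_transient z i t - pgf_limit z)"
      by (rule integrable_pmf_bounded)
    then have int: "integrable (measure_pmf \<pi>) (\<lambda>i. pgf_transient z i t)"
      using Bochner_Integration.integrable_add[of _ _ "\<lambda>_. pgf_limit z"] by fastforce
    have "measure_pmf.expectation \<pi> (\<lambda>n. z ^ n) = measure_pmf.expectation (bind_pmf \<pi> (P t)) (\<lambda>n. z ^ n)"
      using assms(1) that by (simp add: stationary_distribution_def)
    also have "\<dots> = measure_pmf.expectation \<pi> (\<lambda>i. pgf_transient z i t)"
      using z that by (simp add: expectation_bind_pmf[OF pow] expectation_power_eq_pgf_transient)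
    finally have "c = measure_pmf.expectation \<pi> (\<lambda>i. pgf_transient z i t - pgf_limit z)"
      using int by (simp add: c_def)
    then show ?thesis using abs_expectation_pmf_le[OF dist] by simp
  qed
  then have "\<forall>\<^sub>F t in at_top. \<bar>c\<bar> \<le> exp (- (\<kappa> * t))"
    by (rule eventually_mono[OF eventually_ge_at_top[of 0]])
  moreover have "((\<lambda>t. exp (- (\<kappa> * t))) \<longlongrightarrow> 0) at_top"
    using kappa by real_asymp
  ultimately have "\<bar>c\<bar> \<le> 0"
    by (intro tendsto_lowerbound[of _ _ at_top]) auto
  then show ?thesis by (simp add: c_def)
qed

text \<open>As a function of \<open>i\<close> the transient form is a constant plus a multiple of
  \<open>p ^ i\<close>, so its mean under \<pi> only needs the generating function at the thinned
  argument \<open>p\<close>.\<close>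

lemma stationary_if_pgf:
  assumes pgf: "\<And>z. 0 \<le> z \<Longrightarrow> z \<le> 1 \<Longrightarrow> measure_pmf.expectation \<pi> (\<lambda>n. z ^ n) = pgf_limit z"
  shows "stationary_distribution P \<pi>"
  unfolding stationary_distribution_def
proof (intro allI impI pmf_eq_if_pgf_eq)
  fix t z :: real assume t: "0 \<le> t" and z: "0 \<le> z" "z \<le> 1"
  have pow: "\<bar>z ^ n\<bar> \<le> 1" for n using z by (simp add: power_le_one)
  define p where "p = 1 - (1 - z) * exp (- (\<mu> * t))"
  have "(1 - z) * exp (- (\<mu> * t)) \<le> 1"
    using z t mu by (intro mult_le_one) auto
  with z have p: "0 \<le> p" "p \<le> 1" by (auto simp: p_def)
  define q where "q = exp (- (\<theta> * (1 - z) * (1 - exp (- (\<mu> * t)))))"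
  have int: "integrable (measure_pmf \<pi>) (\<lambda>i. p ^ i)"
    using p by (intro integrable_pmf_bounded[where B = 1]) (simp add: power_le_one)
  have "measure_pmf.expectation (bind_pmf \<pi> (P t)) (\<lambda>n. z ^ n) =
      measure_pmf.expectation \<pi> (\<lambda>i. pgf_transient z i t)"
    using z t by (simp add: expectation_bind_pmf[OF pow] expectation_power_eq_pgf_transient)
  also have "\<dots> = measure_pmf.expectation \<pi> (\<lambda>i. pgf_limit z - pgf_reset_loss z t + exp (- (\<kappa> * t)) * q * p ^ i)"
    by (simp add: pgf_transient_def pgf_no_reset_def p_def q_def mult_ac)
  also have "\<dots> = pgf_limit z - pgf_reset_loss z t + exp (- (\<kappa> * t)) * q * pgf_limit p"
    using int by (simp add: pgf[OF p])
  \<comment> \<open>Evaluating at \<open>p\<close> thins the customers present at time 0 and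
    \<open>q\<close> adds the newcomers; the two Poisson exponents combine to
    \<open>\<theta> * (1 - z)\<close>, so this term cancels the loss.\<close>
  also have "exp (- (\<kappa> * t)) * q * pgf_limit p = pgf_reset_loss z t"
  proof -
    have "q * exp (- (\<theta> * (1 - p))) = exp (- (\<theta> * (1 - z)))"
      by (simp add: q_def p_def exp_add[symmetric] algebra_simps diff_divide_distrib add_divide_distrib)
    moreover have "\<theta> * (1 - p) = \<theta> * (1 - z) * exp (- (\<mu> * t))"
      by (simp add: p_def)
    moreover have "exp (- (\<kappa> * t)) * q * pgf_limit p =
        exp (- (\<kappa> * t)) * (q * exp (- (\<theta> * (1 - p)))) * beta1_mgf \<gamma> (\<theta> * (1 - p))"
      by (simp only: pgf_limit_def mult.assoc)
    ultimately show ?thesis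
      by (simp only: pgf_reset_loss_def)
  qed
  finally show "measure_pmf.expectation (bind_pmf \<pi> (P t)) (\<lambda>n. z ^ n) =
      measure_pmf.expectation \<pi> (\<lambda>n. z ^ n)"
    using pgf[OF z] by simp
qed

lemma stationary_distribution_iff:
  "stationary_distribution P \<pi> \<longleftrightarrow> (\<forall>k. pmf \<pi> k = mixed_poisson_mass \<theta> \<gamma> k)"
proof -
  obtain p where p: "\<And>k. pmf p k = mixed_poisson_mass \<theta> \<gamma> k"
    "\<And>z. 0 \<le> z \<Longrightarrow> z \<le> 1 \<Longrightarrow> measure_pmf.expectation p (\<lambda>n. z ^ n) = pgf_limit z"
    using mixed_poisson_exists[OF theta_nonneg gamma_pos] unfolding pgf_limit_def by blast
  have "stationary_distribution P \<pi> \<longleftrightarrow> \<pi> = p"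
    using stationary_if_pgf[of p] stationary_pgf[of \<pi>] p(2) pmf_eq_if_pgf_eq[of \<pi> p] by auto
  then show ?thesis
    using p(1) by (simp add: pmf_eq_iff)
qed

lemma ex1_stationary_distribution: "\<exists>!\<pi>. stationary_distribution P \<pi>"
  using mixed_poisson_exists[OF theta_nonneg gamma_pos]
  by (metis stationary_distribution_iff pmf_eqI)

end

subsection \<open>The stationary distribution\<close>

theorem mainTheorem13:
  fixes lam \<mu> \<kappa> \<theta> \<gamma> :: real
    and r :: "nat \<Rightarrow> nat \<Rightarrow> real"
    and P :: "real \<Rightarrow> nat \<Rightarrow> nat pmf"
  assumes "lam \<ge> 0" and "\<mu> > 0" and "\<kappa> > 0"
    and "\<theta> = lam / \<mu>" and "\<gamma> = \<kappa> / \<mu>"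
    and "r = mm1m_reset_rate lam \<mu> \<mu> \<kappa> \<or> r = mminf_reset_rate lam \<mu> \<kappa>"
    and "ctmc r P"
  shows "(\<exists>!\<pi>. stationary_distribution P \<pi>) \<and>
    (\<forall>\<pi>. stationary_distribution P \<pi> \<longrightarrow>
      (\<forall>k.
        set_integrable lborel {0<..<1} (\<lambda>t. \<gamma> * (1 - t) powr (\<gamma> - 1) * t ^ k * exp (- \<theta> * t)) \<and>
        pmf \<pi> k = \<theta> ^ k / fact k *
          (LBINT t:{0<..<1}. \<gamma> * (1 - t) powr (\<gamma> - 1) * t ^ k * exp (- \<theta> * t)) \<and>
        (\<lambda>j. \<theta> ^ (k + j) * (- 1) ^ j * (fact (k + j) / (fact j * fact k)) *
            (\<Sum>l = 0..k + j. (- 1) ^ l / (fact l * fact (k + j - l)) * (\<gamma> / (\<gamma> + real l))))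
          sums pmf \<pi> k) \<and>
      (\<forall>(M :: 'b measure) X Y.
        prob_space M \<and>
        X \<in> measurable M (count_space UNIV) \<and>
        distributed M lborel Y
          (\<lambda>y. ennreal (indicator {0<..<1} y * (\<gamma> * (1 - y) powr (\<gamma> - 1)))) \<and>
        cond_poisson M X Y (\<lambda>y. \<theta> * y) \<longrightarrow>
        (\<forall>n. pmf \<pi> n = measure M {\<omega> \<in> space M. X \<omega> = n})))"
proof -
  have r: "r = mminf_reset_rate lam \<mu> \<kappa>"
    using assms(6) mm1m_reset_rate_eq_mminf by auto
  interpret reset_queue lam \<mu> \<kappa> P
    using assms r by unfold_locales auto
  have "\<gamma> > 0" "\<theta> \<ge> 0"
    using gamma_pos theta_nonneg assms by simp_all
  have pmf: "pmf \<pi> k = mixed_poisson_mass \<theta> \<gamma> k" if "stationary_distribution P \<pi>" for \<pi> k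
    using that assms(4,5) by (simp add: stationary_distribution_iff)
  show ?thesis
    unfolding assms(4,5)[symmetric]
  proof (intro conjI allI impI ex1_stationary_distribution)
    fix \<pi> k assume \<pi>: "stationary_distribution P \<pi>"
    show "set_integrable lborel {0<..<1} (\<lambda>t. \<gamma> * (1 - t) powr (\<gamma> - 1) * t ^ k * exp (- \<theta> * t))"
      using \<open>\<theta> \<ge> 0\<close> \<open>\<gamma> > 0\<close> by (rule mixed_poisson_mass_integrable)
    show "pmf \<pi> k = \<theta> ^ k / fact k *
        (LBINT t:{0<..<1}. \<gamma> * (1 - t) powr (\<gamma> - 1) * t ^ k * exp (- \<theta> * t))"
      unfolding pmf[OF \<pi>] using \<open>\<gamma> > 0\<close> by (rule mixed_poisson_mass_eq_integral)
    show "(\<lambda>j. \<theta> ^ (k + j) * (- 1) ^ j * (fact (k + j) / (fact j * fact k)) *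
        (\<Sum>l = 0..k + j. (- 1) ^ l / (fact l * fact (k + j - l)) * (\<gamma> / (\<gamma> + real l)))) sums pmf \<pi> k"
      unfolding pmf[OF \<pi>] using \<open>\<gamma> > 0\<close> by (rule mixed_poisson_mass_sums)
  next
    fix \<pi> n and M :: "'b measure" and X Y
    assume \<pi>: "stationary_distribution P \<pi>"
      and "prob_space M \<and> X \<in> measurable M (count_space UNIV) \<and>
        distributed M lborel Y
          (\<lambda>y. ennreal (indicator {0<..<1} y * (\<gamma> * (1 - y) powr (\<gamma> - 1)))) \<and>
        cond_poisson M X Y (\<lambda>y. \<theta> * y)"
    then show "pmf \<pi> n = measure M {\<omega> \<in> space M. X \<omega> = n}"
      unfolding pmf[OF \<pi>] by (intro mixed_poisson_mass_eq_prob[symmetric]) auto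
  qed
qed

end
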